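(* Every deterministic online algorithm for MPMD-Set with size-based delay has competitive ratio $\Omega(n)$, where $n$ is the number of points in the metric space.
   Context: MPMD-Set with size-based delay: a metric space $(V,d)$ with $n$ points; requests arrive online at points of $V$ at discrete timesteps; the algorithm irrevocably matches requests in pairs, eventually producing a perfect matching; at each timestep $t$ a delay function $f_t$ on sets of requests is charged on the set $U_t$ of arrived-but-unmatched requests, where $f_t(\emptyset)=0$, $f_t$ is monotone under inclusion, $\sum_t f_t(U)=\infty$ for nonempty $U$, and $f_t(U)$ depends only on $|U|$ and is non-decreasing in $|U|$. Total cost is the sum of distances of matched pairs plus $\sum_t f_t(U_t)$. Competitive ratio $c$: cost at most $c$ times optimal offline cost on every instance. *)

theory Defs
  imports "HOL-Analysis.Analysis"
begin

text \<open>
  The requests of an instance are a list \<open>rs\<close> of pairs (arrival time, point), sorted by arrival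
  time; a request is identified by its index in \<open>rs\<close>. Several requests may arrive in one timestep.
  By sortedness the requests that have arrived by time \<open>t\<close> form a prefix of \<open>rs\<close>, so indices into
  the prefix and into \<open>rs\<close> agree.
\<close>

type_synonym 'a requests = "(nat \<times> 'a) list"

definition arrived :: "'a requests \<Rightarrow> nat \<Rightarrow> 'a requests" where
  "arrived rs t = filter (\<lambda>(s, x). s \<le> t) rs"

text \<open>
  A delay function assigns a cost to each timestep and each finite set of request indices.
  Nonnegativity follows from the first two conditions.
\<close>

type_synonym delay = "nat \<Rightarrow> nat set \<Rightarrow> real"

definition set_delay :: "delay \<Rightarrow> bool" where
  "set_delay f \<longleftrightarrow>
     (\<forall>t. f t {} = 0) \<and>
     (\<forall>t U W. finite W \<and> U \<subseteq> W \<longrightarrow> f t U \<le> f t W) \<and>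
     (\<forall>U. finite U \<and> U \<noteq> {} \<longrightarrow> (\<Sum>t. ennreal (f t U)) = \<infinity>)"

definition size_based :: "delay \<Rightarrow> bool" where
  "size_based f \<longleftrightarrow>
     (\<exists>g :: nat \<Rightarrow> nat \<Rightarrow> real.
        (\<forall>t. mono (g t)) \<and> (\<forall>t U. finite U \<longrightarrow> f t U = g t (card U)))"

definition mpmd_instance ::
  "nat \<Rightarrow> 'a set \<Rightarrow> ('a \<Rightarrow> 'a \<Rightarrow> real) \<Rightarrow> delay \<Rightarrow> 'a requests \<Rightarrow> bool" where
  "mpmd_instance n V d f rs \<longleftrightarrow>
     Metric_space V d \<and> finite V \<and> card V = n \<and>
     set_delay f \<and> size_based f \<and>
     sorted (map fst rs) \<and> snd ` set rs \<subseteq> V \<and> even (length rs)"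

text \<open>
  A solution is given by the set \<open>S t\<close> of pairs of requests that are matched at each timestep \<open>t\<close>.
  An unordered pair of requests is written as \<open>(i, j)\<close> with \<open>i < j\<close>. The unique existence says that
  every request is matched exactly once, over all times, so that the pairs form a perfect matching
  and no decision is ever revised.
\<close>

type_synonym solution = "nat \<Rightarrow> (nat \<times> nat) set"

definition feasible :: "'a requests \<Rightarrow> solution \<Rightarrow> bool" where
  "feasible rs S \<longleftrightarrow>
     (\<forall>t. \<forall>(i, j) \<in> S t. i < j \<and> j < length (arrived rs t)) \<and>
     (\<forall>k < length rs. \<exists>!(t, i, j). (i, j) \<in> S t \<and> (k = i \<or> k = j))"

text \<open>
  Within a timestep, first requests arrive, then pairs are matched, and then the delay cost is
  charged on the requests that remain.
\<close>

definition pending :: "'a requests \<Rightarrow> solution \<Rightarrow> nat \<Rightarrow> nat set" where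
  "pending rs S t = {..<length (arrived rs t)} - (\<Union>s\<le>t. \<Union>(i, j)\<in>S s. {i, j})"

definition cost :: "('a \<Rightarrow> 'a \<Rightarrow> real) \<Rightarrow> delay \<Rightarrow> 'a requests \<Rightarrow> solution \<Rightarrow> ennreal" where
  "cost d f rs S =
     ennreal (\<Sum>(i, j)\<in>(\<Union>t. S t). d (snd (rs ! i)) (snd (rs ! j))) +
     (\<Sum>t. ennreal (f t (pending rs S t)))"

definition opt :: "('a \<Rightarrow> 'a \<Rightarrow> real) \<Rightarrow> delay \<Rightarrow> 'a requests \<Rightarrow> ennreal" where
  "opt d f rs = (INF S\<in>{S. feasible rs S}. cost d f rs S)"

text \<open>
  A deterministic online algorithm computes the pairs to match at time \<open>t\<close> from the metric space,
  the delay function and the requests that have arrived by time \<open>t\<close>; its own earlier decisions are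
  determined by these data. The whole delay function is passed, so clairvoyant algorithms are
  included; the non-clairvoyant ones are those whose output at time \<open>t\<close> depends on \<open>f\<close> only through
  its values at times up to \<open>t\<close>. The points are natural numbers, which covers every finite metric
  space up to isometry.
\<close>

type_synonym algorithm =
  "nat set \<Rightarrow> (nat \<Rightarrow> nat \<Rightarrow> real) \<Rightarrow> delay \<Rightarrow> nat \<Rightarrow> nat requests \<Rightarrow> (nat \<times> nat) set"

definition run ::
  "algorithm \<Rightarrow> nat set \<Rightarrow> (nat \<Rightarrow> nat \<Rightarrow> real) \<Rightarrow> delay \<Rightarrow> nat requests \<Rightarrow> solution" where
  "run A V d f rs t = A V d f t (arrived rs t)"

definition online_algorithm :: "algorithm \<Rightarrow> bool" where
  "online_algorithm A \<longleftrightarrow>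
     (\<forall>n V d f rs. mpmd_instance n V d f rs \<longrightarrow> feasible rs (run A V d f rs))"

definition competitive :: "algorithm \<Rightarrow> nat \<Rightarrow> ennreal \<Rightarrow> bool" where
  "competitive A n r \<longleftrightarrow>
     (\<forall>V d f rs. mpmd_instance n V d f rs \<longrightarrow> cost d f rs (run A V d f rs) \<le> r * opt d f rs)"

definition competitive_ratio :: "algorithm \<Rightarrow> nat \<Rightarrow> ennreal" where
  "competitive_ratio A n = Inf {r. competitive A n r}"

end

theory Submission
  imports Defs
begin

text \<open>
  On the uniform metric, let waiting be free as long as fewer than \<open>n\<close> requests are pending. The
  adversary always requests a point without pending requests of the algorithm, so that every pair
  the algorithm ever matches has cost \<open>1\<close>. An offline solution merges the least requested point
  \<open>a\<close> with another point and matches greedily within the resulting \<open>n - 1\<close> classes: it never has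
  \<open>n\<close> pending requests, and apart from the at most \<open>n - 1\<close> requests left over at the end it pays
  only for pairs that contain a request at \<open>a\<close>. With \<open>2 * n\<^sup>2\<close> requests the algorithm pays at
  least \<open>n\<^sup>2\<close> and the offline solution at most \<open>3 * n\<close>.
\<close>

section \<open>Feasible solutions as perfect matchings of the request indices\<close>

lemma feasible_unique:
  assumes "feasible rs S" "(i, j) \<in> S t" "(i', j') \<in> S t'"
    and "k = i \<or> k = j" "k = i' \<or> k = j'"
  shows "t = t' \<and> i = i' \<and> j = j'"
proof -
  have "i < j" "j < length (arrived rs t)"
    using assms(1,2) by (auto simp: feasible_def)
  moreover have "length (arrived rs t) \<le> length rs"
    by (simp add: arrived_def)
  ultimately have "k < length rs"
    using assms(4) by auto
  then have "\<exists>!(t, i, j). (i, j) \<in> S t \<and> (k = i \<or> k = j)"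
    using assms(1) by (auto simp: feasible_def)
  then obtain e where "\<And>e'. (case e' of (t, i, j) \<Rightarrow> (i, j) \<in> S t \<and> (k = i \<or> k = j)) \<Longrightarrow> e' = e"
    by (elim ex1E) blast
  from this[of "(t, i, j)"] this[of "(t', i', j')"] show ?thesis
    using assms(2-) by simp
qed

text \<open>Double counting, as each index lies in exactly one pair. The constant weight 1/2 will
  count the pairs of a solution, and indicator weights will distribute the cost of offline pairs
  over single requests.\<close>

lemma feasible_sum_pairs:
  fixes h :: "nat \<Rightarrow> real"
  assumes "feasible rs S"
  shows "finite (\<Union>t. S t)"
    and "(\<Sum>(i, j)\<in>(\<Union>t. S t). h i + h j) = (\<Sum>k<length rs. h k)"
proof -
  define P where "P = (\<Union>t. S t)"
  have *: "i < j \<and> j < length rs" if "(i, j) \<in> P" for i j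
  proof -
    obtain t where "(i, j) \<in> S t"
      using \<open>(i, j) \<in> P\<close> by (auto simp: P_def)
    then have "i < j" "j < length (arrived rs t)"
      using assms by (auto simp: feasible_def)
    moreover have "length (arrived rs t) \<le> length rs"
      by (simp add: arrived_def)
    ultimately show ?thesis by simp
  qed
  have "P \<subseteq> {..<length rs} \<times> {..<length rs}"
    using * by fastforce
  then have fin: "finite P"
    by (rule finite_subset) auto
  then show "finite (\<Union>t. S t)"
    by (simp add: P_def)
  have "(\<Sum>(i, j)\<in>P. h i + h j) = (\<Sum>e\<in>P. \<Sum>k\<in>{fst e, snd e}. h k)"
    using * by (intro sum.cong) fastforce+
  also have "\<dots> = sum h (\<Union>e\<in>P. {fst e, snd e})"
  proof (rule sum.UNION_disjoint[symmetric])
    show "\<forall>e\<in>P. \<forall>e'\<in>P. e \<noteq> e' \<longrightarrow> {fst e, snd e} \<inter> {fst e', snd e'} = {}"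
    proof (intro ballI impI, rule ccontr)
      fix e e' assume "e \<in> P" "e' \<in> P" "e \<noteq> e'" "{fst e, snd e} \<inter> {fst e', snd e'} \<noteq> {}"
      then obtain t t' k where "(fst e, snd e) \<in> S t" "(fst e', snd e') \<in> S t'"
        "k = fst e \<or> k = snd e" "k = fst e' \<or> k = snd e'"
        by (auto simp: P_def)
      then have "e = e'"
        using feasible_unique[OF assms] by (meson prod.expand)
      with \<open>e \<noteq> e'\<close> show False ..
    qed
  qed (use fin in auto)
  also have "(\<Union>e\<in>P. {fst e, snd e}) = {..<length rs}"
  proof
    show "(\<Union>e\<in>P. {fst e, snd e}) \<subseteq> {..<length rs}"
      using * by fastforce
    show "{..<length rs} \<subseteq> (\<Union>e\<in>P. {fst e, snd e})"
    proof
      fix k assume "k \<in> {..<length rs}"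
      then have "\<exists>!(t, i, j). (i, j) \<in> S t \<and> (k = i \<or> k = j)"
        using assms by (auto simp: feasible_def)
      then obtain t i j where "(i, j) \<in> S t" "k = i \<or> k = j"
        by auto
      then show "k \<in> (\<Union>e\<in>P. {fst e, snd e})"
        by (force simp: P_def)
    qed
  qed
  finally show "(\<Sum>(i, j)\<in>(\<Union>t. S t). h i + h j) = (\<Sum>k<length rs. h k)"
    by (simp add: P_def)
qed

text \<open>\<open>U t\<close> stands for the requests still unmatched just before request
  \<open>t\<close> arrives at time \<open>t\<close>. Feasibility is global in time; this reduces it
  to conditions on single timesteps and to \<open>U\<close> being empty after time \<open>m\<close>,
  the first timestep without an arrival.\<close>

lemma feasible_and_pending_of_process:
  assumes len: "length rs = m" "\<And>t. length (arrived rs t) = min m (Suc t)"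
    and U0: "U 0 = {}" and Um: "U (Suc m) = {}"
    and step: "\<And>t. U (Suc t) = (U t \<union> ({t} \<inter> {..<m})) - (\<Union>(i, j)\<in>S t. {i, j})"
    and cov: "\<And>t i j. (i, j) \<in> S t \<Longrightarrow>
      i < j \<and> i \<in> U t \<union> ({t} \<inter> {..<m}) \<and> j \<in> U t \<union> ({t} \<inter> {..<m})"
    and uniq: "\<And>t i j i' j' k. (i, j) \<in> S t \<Longrightarrow> (i', j') \<in> S t \<Longrightarrow> k = i \<or> k = j \<Longrightarrow>
      k = i' \<or> k = j' \<Longrightarrow> i = i' \<and> j = j'"
  shows "feasible rs S" and "pending rs S t = U (Suc t)"
proof -
  have U: "U t = {..<min m t} - (\<Union>s<t. \<Union>(i, j)\<in>S s. {i, j})" for t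
  proof (induction t)
    case (Suc t)
    have "{..<min m (Suc t)} = {..<min m t} \<union> ({t} \<inter> {..<m})"
      by auto
    \<comment> \<open>No request is matched before it arrives, so adding \<open>t\<close> commutes
      with removing the requests matched earlier.\<close>
    moreover have "t \<notin> (\<Union>s<t. \<Union>(i, j)\<in>S s. {i, j})"
    proof
      assume "t \<in> (\<Union>s<t. \<Union>(i, j)\<in>S s. {i, j})"
      then obtain s i j where s: "s < t" "(i, j) \<in> S s" "t = i \<or> t = j"
        by auto
      have "U s \<subseteq> {..<s}" for s
        by (induction s) (use U0 step in \<open>auto simp: less_Suc_eq\<close>)
      then show False
        using cov[OF s(2)] s(1,3) by (metis UnE Int_iff lessThan_iff singletonD subsetD
            less_irrefl less_trans)
    qed
    ultimately show ?case
      unfolding step Suc.IH lessThan_Suc by auto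
  qed (simp add: U0)
  show "pending rs S t = U (Suc t)" for t
    unfolding U pending_def len lessThan_Suc_atMost by simp
  show "feasible rs S"
    unfolding feasible_def
  proof (intro conjI allI impI ballI)
    fix t e assume "e \<in> S t"
    then show "case e of (i, j) \<Rightarrow> i < j \<and> j < length (arrived rs t)"
      using cov[of "fst e" "snd e" t] U[of t] by (auto simp: len)
  next
    fix k assume "k < length rs"
    then have "k < min m (Suc m)"
      using len(1) by simp
    then obtain t i j where t: "(i, j) \<in> S t" "k = i \<or> k = j"
      using Um unfolding U by auto
    have later: False if "(i, j) \<in> S t" "k = i \<or> k = j" "(i', j') \<in> S t'" "k = i' \<or> k = j'"
      "t < t'" for i j t i' j' t'
    proof -
      have "k \<in> U t' \<union> {t'}"
        using cov[OF that(3)] that(4) by auto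
      moreover have "k \<noteq> t'"
        using cov[OF that(1)] that(2,5) U[of t] by auto
      moreover have "k \<notin> U t'"
        unfolding U using that by fastforce
      ultimately show False by simp
    qed
    show "\<exists>!(t, i, j). (i, j) \<in> S t \<and> (k = i \<or> k = j)"
    proof (rule ex1I[of _ "(t, i, j)"])
      fix e assume "case e of (t, i, j) \<Rightarrow> (i, j) \<in> S t \<and> (k = i \<or> k = j)"
      then obtain t' i' j' where e: "e = (t', i', j')" "(i', j') \<in> S t'" "k = i' \<or> k = j'"
        by (cases e) auto
      have "t' = t"
        using later[OF t e(2,3)] later[OF e(2,3) t] by (meson linorder_neqE_nat)
      then show "e = (t, i, j)"
        using uniq[of i j t i' j' k] t e by auto
    qed (use t in simp)
  qed
qed

section \<open>Greedy matching within classes, and perfect matching of the leftovers\<close>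

text \<open>Disjointness of pairs is phrased through a shared index \<open>k\<close>, in the form of
  the hypothesis \<open>uniq\<close> of \<open>feasible_and_pending_of_process\<close>.\<close>

definition perfect_matching_on :: "nat set \<Rightarrow> (nat \<times> nat) set \<Rightarrow> bool" where
  "perfect_matching_on X M \<longleftrightarrow> (\<Union>(i, j)\<in>M. {i, j}) = X \<and> (\<forall>(i, j)\<in>M. i < j) \<and>
    (\<forall>i j i' j' k. (i, j) \<in> M \<and> (i', j') \<in> M \<and> (k = i \<or> k = j) \<and> (k = i' \<or> k = j') \<longrightarrow>
      i = i' \<and> j = j')"

lemma perfect_matching_on_insert:
  assumes "perfect_matching_on X M" "i \<notin> X" "j \<notin> X" "i < j"
  shows "perfect_matching_on (insert i (insert j X)) (insert (i, j) M)"
proof -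
  have M: "(\<Union>(i, j)\<in>M. {i, j}) = X" "\<forall>(i, j)\<in>M. i < j"
    and uniq: "\<And>i j i' j' k. (i, j) \<in> M \<Longrightarrow> (i', j') \<in> M \<Longrightarrow> k = i \<or> k = j \<Longrightarrow>
      k = i' \<or> k = j' \<Longrightarrow> i = i' \<and> j = j'"
    using assms(1) unfolding perfect_matching_on_def by blast+
  have notin: "i' \<noteq> i \<and> i' \<noteq> j \<and> j' \<noteq> i \<and> j' \<noteq> j" if "(i', j') \<in> M" for i' j'
    using M(1) that assms(2,3) by blast
  have "i1 = i2 \<and> j1 = j2"
    if "(i1, j1) \<in> insert (i, j) M" "(i2, j2) \<in> insert (i, j) M"
      "k = i1 \<or> k = j1" "k = i2 \<or> k = j2" for i1 j1 i2 j2 k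
  proof (cases "(i1, j1) \<in> M \<and> (i2, j2) \<in> M")
    case True
    then show ?thesis
      using uniq that(3,4) by blast
  next
    case False
    then show ?thesis
      using that notin[of i1 j1] notin[of i2 j2] by auto
  qed
  moreover have "(\<Union>(i, j)\<in>insert (i, j) M. {i, j}) = insert i (insert j X)"
    using M(1) by simp
  moreover have "\<forall>(i, j)\<in>insert (i, j) M. i < j"
    using M(2) assms(4) by simp
  ultimately show ?thesis
    unfolding perfect_matching_on_def by blast
qed

lemma even_card_perfect_matching:
  assumes "finite X" "even (card X)"
  shows "\<exists>M. perfect_matching_on X M"
  using assms
proof (induction "card X" arbitrary: X rule: less_induct)
  case less
  show ?case
  proof (cases "X = {}")
    case True
    then show ?thesis
      by (intro exI[of _ "{}"]) (simp add: perfect_matching_on_def)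
  next
    case False
    have ge: "card X \<ge> 2"
      using less.prems False by (metis card_0_eq dvd_imp_le gr0I)
    then obtain Y where "Y \<subseteq> X" "card Y = 2"
      by (meson obtain_subset_with_card_n)
    then obtain x y where xy: "Y = {x, y}" "x \<noteq> y"
      by (auto simp: card_2_iff)
    define i j where "i = min x y" and "j = max x y"
    have ij: "i \<in> X" "j \<in> X" "i < j"
      using xy \<open>Y \<subseteq> X\<close> by (auto simp: i_def j_def min_def max_def)
    have "card (X - {i, j}) = card X - 2"
      using ij less.prems by (subst card_Diff_subset) auto
    then obtain M where "perfect_matching_on (X - {i, j}) M"
      using less.hyps[of "X - {i, j}"] less.prems ge by auto
    then have "perfect_matching_on (insert i (insert j (X - {i, j}))) (insert (i, j) M)"
      using ij by (intro perfect_matching_on_insert) auto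
    moreover have "insert i (insert j (X - {i, j})) = X"
      using ij by auto
    ultimately show ?thesis by auto
  qed
qed

text \<open>Pending requests before time \<open>t\<close> of greedy matching within classes, where request \<open>t\<close>
  arrives at time \<open>t\<close> and has class \<open>c t\<close>.\<close>

primrec greedy_pending :: "(nat \<Rightarrow> 'b) \<Rightarrow> nat \<Rightarrow> nat set" where
  "greedy_pending c 0 = {}"
| "greedy_pending c (Suc t) =
     (if \<exists>i\<in>greedy_pending c t. c i = c t then {i \<in> greedy_pending c t. c i \<noteq> c t}
      else insert t (greedy_pending c t))"

lemma greedy_pending_less: "i \<in> greedy_pending c t \<Longrightarrow> i < t"
  by (induction t) (auto split: if_splits simp: less_Suc_eq)

lemma finite_greedy_pending: "finite (greedy_pending c t)"
  by (rule finite_subset[of _ "{..<t}"]) (auto dest: greedy_pending_less)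

text \<open>A request stays only if its class is not yet represented. Hence there are never more
  pending requests than classes.\<close>

lemma greedy_pending_inj: "inj_on c (greedy_pending c t)"
  by (induction t) (auto simp: inj_on_def)

text \<open>By injectivity an arrival removes exactly one request or adds one, so the parity
  alternates. This lets the leftovers of an even number of requests be paired off.\<close>

lemma even_card_greedy_pending: "even (card (greedy_pending c t)) \<longleftrightarrow> even t"
proof (induction t)
  case (Suc t)
  show ?case
  proof (cases "\<exists>i\<in>greedy_pending c t. c i = c t")
    case True
    then obtain i where i: "i \<in> greedy_pending c t" "c i = c t" by auto
    then have "{i \<in> greedy_pending c t. c i \<noteq> c t} = greedy_pending c t - {i}"
      using greedy_pending_inj[of c t] by (auto simp: inj_on_def)
    moreover have "card (greedy_pending c t) > 0"
      using i finite_greedy_pending by (metis card_gt_0_iff empty_iff)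
    ultimately show ?thesis
      using Suc True i by (auto simp: finite_greedy_pending)
  next
    case False
    then show ?thesis
      using Suc greedy_pending_less[of t c t] by (auto simp: finite_greedy_pending card_insert_if)
  qed
qed simp

lemma exists_greedy_solution:
  assumes len: "length rs = m" "\<And>t. length (arrived rs t) = min m (Suc t)" and "even m"
  obtains S where "feasible rs S"
    and "\<And>t. pending rs S t = (if t < m then greedy_pending c (Suc t) else {})"
    and "\<And>t i j. (i, j) \<in> S t \<Longrightarrow> c i = c j \<or> i \<in> greedy_pending c m \<and> j \<in> greedy_pending c m"
proof -
  obtain M where "perfect_matching_on (greedy_pending c m) M"
    using even_card_perfect_matching[OF finite_greedy_pending, of c m]
      even_card_greedy_pending[of c m] \<open>even m\<close> by auto
  then have M: "(\<Union>(i, j)\<in>M. {i, j}) = greedy_pending c m" "\<forall>(i, j)\<in>M. i < j"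
    "\<And>i j i' j' k. (i, j) \<in> M \<Longrightarrow> (i', j') \<in> M \<Longrightarrow> k = i \<or> k = j \<Longrightarrow>
      k = i' \<or> k = j' \<Longrightarrow> i = i' \<and> j = j'"
    unfolding perfect_matching_on_def by blast+
  have Mi: "i \<in> greedy_pending c m \<and> j \<in> greedy_pending c m" if "(i, j) \<in> M" for i j
    using M(1) that by blast
  \<comment> \<open>The leftovers are matched at time \<open>m\<close>, after the last arrival.
    Matching precedes the delay charge, so nothing is charged from time \<open>m\<close> on.\<close>
  define S where "S t = (if t < m then {(i, t) | i. i \<in> greedy_pending c t \<and> c i = c t}
    else if t = m then M else {})" for t
  define U where "U t = (if t \<le> m then greedy_pending c t else {})" for t
  have step: "U (Suc t) = (U t \<union> ({t} \<inter> {..<m})) - (\<Union>(i, j)\<in>S t. {i, j})" for t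
  proof -
    consider "t < m" | "t = m" | "t > m" by linarith
    then show ?thesis
    proof cases
      case 1
      then show ?thesis
        by (auto simp: U_def S_def dest: greedy_pending_less)
    next
      case 2
      then show ?thesis
        using M(1) by (simp add: U_def S_def)
    qed (simp add: U_def)
  qed
  have cov: "i < j \<and> i \<in> U t \<union> ({t} \<inter> {..<m}) \<and> j \<in> U t \<union> ({t} \<inter> {..<m})"
    if "(i, j) \<in> S t" for t i j
    using that M(2) Mi by (auto simp: U_def S_def split: if_splits dest: greedy_pending_less)
  have uniq: "i = i' \<and> j = j'"
    if "(i, j) \<in> S t" "(i', j') \<in> S t" "k = i \<or> k = j" "k = i' \<or> k = j'" for t i j i' j' k
  proof (cases "t < m")
    case True
    then show ?thesis
      using that greedy_pending_inj[of c t] by (auto simp: S_def inj_on_def)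
  next
    case False
    then show ?thesis
      using that M(3)[of i j i' j' k] by (simp add: S_def split: if_splits)
  qed
  have U: "U 0 = {}" "U (Suc m) = {}"
    by (simp_all add: U_def)
  have process: "feasible rs S" "pending rs S t = U (Suc t)" for t
    by (rule feasible_and_pending_of_process[of rs m U S, OF len U step]; fact cov uniq)+
  show thesis
  proof (rule that)
    show "feasible rs S"
      by (rule process(1))
    show "pending rs S t = (if t < m then greedy_pending c (Suc t) else {})" for t
      using process(2)[of t] by (auto simp: U_def simp del: greedy_pending.simps)
    show "c i = c j \<or> i \<in> greedy_pending c m \<and> j \<in> greedy_pending c m"
      if "(i, j) \<in> S t" for t i j
      using that Mi by (auto simp: S_def split: if_splits)
  qed
qed

section \<open>The uniform metric and the delay function\<close>

definition uniform_dist :: "'a \<Rightarrow> 'a \<Rightarrow> real" where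
  "uniform_dist x y = (if x = y then 0 else 1)"

text \<open>The threshold drops to 1 from time \<open>m\<close> on because the total delay of every
  nonempty set has to diverge. \<open>H\<close> is the penalty for reaching \<open>n\<close> pending
  requests while requests still arrive.\<close>

definition threshold_delay :: "nat \<Rightarrow> nat \<Rightarrow> real \<Rightarrow> delay" where
  "threshold_delay n m H t U = (if card U \<ge> (if t < m then n else 1) then H else 0)"

lemma Metric_space_uniform_dist: "Metric_space V uniform_dist"
  by unfold_locales (auto simp: uniform_dist_def)

lemma set_delay_threshold_delay:
  assumes "n \<ge> 1" "H > 0"
  shows "set_delay (threshold_delay n m H)"
  unfolding set_delay_def
proof (intro conjI allI impI)
  fix t U W assume *: "finite (W :: nat set) \<and> U \<subseteq> W"
  then have "card U \<le> card W"
    by (simp add: card_mono)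
  then show "threshold_delay n m H t U \<le> threshold_delay n m H t W"
    using assms by (auto simp: threshold_delay_def)
next
  fix U :: "nat set" assume "finite U \<and> U \<noteq> {}"
  then have "card U \<ge> 1"
    by (simp add: Suc_leI card_gt_0_iff)
  then have H: "threshold_delay n m H t U = H" if "t \<ge> m" for t
    using that by (auto simp: threshold_delay_def)
  show "(\<Sum>t. ennreal (threshold_delay n m H t U)) = \<infinity>"
  proof (rule ccontr)
    assume "(\<Sum>t. ennreal (threshold_delay n m H t U)) \<noteq> \<infinity>"
    then have "summable (\<lambda>t. threshold_delay n m H t U)"
      using assms by (intro summable_suminf_not_top) (auto simp: threshold_delay_def)
    then have "(\<lambda>t. threshold_delay n m H t U) \<longlonglongrightarrow> 0"
      by (rule summable_LIMSEQ_zero)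
    moreover have "(\<lambda>t. threshold_delay n m H t U) \<longlonglongrightarrow> H"
      by (rule tendsto_eventually) (use H in \<open>auto simp: eventually_sequentially\<close>)
    ultimately show False
      using LIMSEQ_unique assms by fastforce
  qed
qed (use assms in \<open>auto simp: threshold_delay_def\<close>)

lemma size_based_threshold_delay:
  assumes "H > 0"
  shows "size_based (threshold_delay n m H)"
  unfolding size_based_def
  by (intro exI[of _ "\<lambda>t k. if k \<ge> (if t < m then n else 1) then H else 0"])
    (use assms in \<open>auto simp: threshold_delay_def mono_def\<close>)

section \<open>The adaptive adversary\<close>

context
  fixes A :: algorithm and V :: "nat set" and f :: delay
begin

abbreviation sol :: "nat requests \<Rightarrow> solution" where
  "sol \<equiv> run A V uniform_dist f"

text \<open>If all points of \<open>V\<close> carry pending requests, the requested point is an arbitrary one of \<open>V\<close>.\<close>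

definition next_point :: "nat requests \<Rightarrow> nat" where
  "next_point rs = (SOME x. x \<in> V \<and>
     ((\<lambda>k. snd (rs ! k)) ` pending rs (sol rs) (length rs - 1) \<subset> V \<longrightarrow>
      x \<notin> (\<lambda>k. snd (rs ! k)) ` pending rs (sol rs) (length rs - 1)))"

text \<open>Since \<open>A\<close> is deterministic and \<open>f\<close> is fixed beforehand, the
  adaptive choices unroll into a fixed list, each prefix of which determines the next point.\<close>

primrec adversary :: "nat \<Rightarrow> nat requests" where
  "adversary 0 = []"
| "adversary (Suc t) = adversary t @ [(t, next_point (adversary t))]"

lemma length_adversary [simp]: "length (adversary m) = m"
  by (induction m) auto

lemma adversary_nth: "k < m \<Longrightarrow> adversary m ! k = (k, next_point (adversary k))"
  by (induction m) (auto simp: nth_append less_Suc_eq)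

lemma adversary_fst: "map fst (adversary m) = [0..<m]"
  by (induction m) auto

lemma arrived_adversary: "arrived (adversary m) t = adversary (min m (Suc t))"
  by (induction m) (auto simp: arrived_def min_def le_Suc_eq)

text \<open>This is where \<open>A\<close> being online enters: up to time \<open>t\<close> it
  cannot tell the full list from its prefix. So the pending set seen by the adversary is the one
  that occurs in the full run.\<close>

lemma pending_adversary:
  assumes "t < m"
  shows "pending (adversary m) (sol (adversary m)) t =
    pending (adversary (Suc t)) (sol (adversary (Suc t))) t"
proof -
  have "sol (adversary m) s = sol (adversary (Suc t)) s" if "s \<le> t" for s
    using that assms by (auto simp: run_def arrived_adversary min_def le_Suc_eq simp del: adversary.simps)
  then show ?thesis
    using assms by (simp add: pending_def arrived_adversary del: adversary.simps)
qed

lemma pending_adversary_subset: "pending (adversary m) S t \<subseteq> {..<m}"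
  by (auto simp: pending_def arrived_adversary)

context
  assumes V: "finite V" "V \<noteq> {}"
begin

lemma next_point:
  shows "next_point rs \<in> V"
    and "(\<lambda>k. snd (rs ! k)) ` pending rs (sol rs) (length rs - 1) \<subset> V \<Longrightarrow>
      next_point rs \<notin> (\<lambda>k. snd (rs ! k)) ` pending rs (sol rs) (length rs - 1)"
proof -
  have "\<exists>x. x \<in> V \<and> ((\<lambda>k. snd (rs ! k)) ` pending rs (sol rs) (length rs - 1) \<subset> V \<longrightarrow>
      x \<notin> (\<lambda>k. snd (rs ! k)) ` pending rs (sol rs) (length rs - 1))"
    using V(2) by blast
  from someI_ex[OF this, folded next_point_def]
  show "next_point rs \<in> V"
    and "(\<lambda>k. snd (rs ! k)) ` pending rs (sol rs) (length rs - 1) \<subset> V \<Longrightarrow>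
      next_point rs \<notin> (\<lambda>k. snd (rs ! k)) ` pending rs (sol rs) (length rs - 1)"
    by auto
qed

lemma adversary_in: "snd ` set (adversary m) \<subseteq> V"
  by (induction m) (auto simp: next_point(1))

text \<open>While fewer than \<open>card V\<close> requests are pending, some point carries none and
  \<open>next_point\<close> picks such a point. The later request of a pair arrives while the
  earlier one is pending, so it lies elsewhere.\<close>

lemma adversary_pairs_distinct:
  assumes feas: "feasible (adversary m) (sol (adversary m))"
    and small: "\<And>t. t < m \<Longrightarrow> card (pending (adversary m) (sol (adversary m)) t) < card V"
    and ij: "(i, j) \<in> sol (adversary m) t"
  shows "snd (adversary m ! i) \<noteq> snd (adversary m ! j)"
proof -
  have "i < j" "j < m" "j \<le> t"
    using feas ij by (fastforce simp: feasible_def arrived_adversary)+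
  \<comment> \<open>This is the set that \<open>next_point (adversary j)\<close> inspects. As
    \<open>i < j\<close> makes \<open>j\<close> positive, \<open>j - 1\<close> really is the
    preceding timestep.\<close>
  define P where "P = pending (adversary j) (sol (adversary j)) (j - 1)"
  have P: "P = pending (adversary m) (sol (adversary m)) (j - 1)"
    using pending_adversary[of "j - 1" m] \<open>i < j\<close> \<open>j < m\<close> by (simp add: P_def)
  \<comment> \<open>The only pair containing \<open>i\<close> is matched at \<open>t\<close>, which
    is not before \<open>j\<close>, the arrival time of its partner.\<close>
  have "i \<in> P"
    unfolding P pending_def
  proof
    show "i \<in> {..<length (arrived (adversary m) (j - 1))}"
      using \<open>i < j\<close> \<open>j < m\<close> by (simp add: arrived_adversary)
    show "i \<notin> (\<Union>s\<le>j - 1. \<Union>(i, j)\<in>sol (adversary m) s. {i, j})"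
    proof
      assume "i \<in> (\<Union>s\<le>j - 1. \<Union>(i, j)\<in>sol (adversary m) s. {i, j})"
      then obtain s i' j' where "s \<le> j - 1" "(i', j') \<in> sol (adversary m) s" "i = i' \<or> i = j'"
        by auto
      with feasible_unique[OF feas ij, of i' j' s i] have "s = t"
        by auto
      with \<open>s \<le> j - 1\<close> \<open>i < j\<close> \<open>j \<le> t\<close> show False by linarith
    qed
  qed
  have "P \<subseteq> {..<j}"
    unfolding P_def by (rule pending_adversary_subset)
  then have "finite P"
    by (rule finite_subset) auto
  have "(\<lambda>k. snd (adversary j ! k)) ` P \<subseteq> V"
    using \<open>P \<subseteq> {..<j}\<close> adversary_in[of j] by (force simp: adversary_nth next_point(1))
  moreover have "card ((\<lambda>k. snd (adversary j ! k)) ` P) < card V"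
    using card_image_le[OF \<open>finite P\<close>] small[of "j - 1"] \<open>j < m\<close> unfolding P
    by (meson le_less_trans less_imp_diff_less)
  ultimately have "(\<lambda>k. snd (adversary j ! k)) ` P \<subset> V"
    by auto
  then have "next_point (adversary j) \<notin> (\<lambda>k. snd (adversary j ! k)) ` P"
    using next_point(2)[of "adversary j"] by (simp add: P_def)
  then show ?thesis
    using imageI[OF \<open>i \<in> P\<close>, of "\<lambda>k. snd (adversary j ! k)"] \<open>i < j\<close> \<open>j < m\<close>
    by (auto simp only: adversary_nth snd_conv less_trans)
qed

end

end

section \<open>The cost of the algorithm\<close>

text \<open>The penalty \<open>m / 2\<close> is what \<open>m / 2\<close> pairs at distance 1 cost.
  Either all pairs have distance 1, or the algorithm once has \<open>n\<close> pending requests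
  before time \<open>m\<close> and this single charge suffices.\<close>

lemma adversary_cost_ge:
  fixes A V n m
  defines "f \<equiv> threshold_delay n m (real m / 2)"
  assumes "finite V" "card V = n" "n \<ge> 1"
    and feas: "feasible (adversary A V f m) (run A V uniform_dist f (adversary A V f m))"
  shows "ennreal (real m / 2) \<le>
    cost uniform_dist f (adversary A V f m) (run A V uniform_dist f (adversary A V f m))"
proof -
  define rs S where "rs = adversary A V f m" and "S = run A V uniform_dist f rs"
  note feas = feas[folded rs_def, folded S_def]
  have "V \<noteq> {}"
    using assms by auto
  show ?thesis
  proof (cases "\<forall>t<m. card (pending rs S t) < card V")
    case True
    have "snd (rs ! i) \<noteq> snd (rs ! j)" if "(i, j) \<in> S t" for i j t
      using adversary_pairs_distinct[OF \<open>finite V\<close> \<open>V \<noteq> {}\<close>, of A f m i j t] feas that True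
      by (simp add: rs_def S_def)
    \<comment> \<open>The 1 is split evenly between both requests so that
      \<open>feasible_sum_pairs\<close> counts the pairs.\<close>
    then have "(\<Sum>(i, j)\<in>(\<Union>t. S t). uniform_dist (snd (rs ! i)) (snd (rs ! j))) =
        (\<Sum>(i, j)\<in>(\<Union>t. S t). 1 / 2 + 1 / 2)"
      by (intro sum.cong) (auto simp: uniform_dist_def)
    also have "\<dots> = real m / 2"
      by (subst feasible_sum_pairs(2)[OF feas]) (simp add: rs_def)
    finally have "ennreal (real m / 2) \<le> cost uniform_dist f rs S"
      unfolding cost_def by (simp only: le_iff_add) blast
    then show ?thesis
      by (simp add: rs_def S_def)
  next
    case False
    then obtain t where t: "t < m" "card (pending rs S t) \<ge> n"
      using \<open>card V = n\<close> by force
    then have "ennreal (real m / 2) = (\<Sum>t\<in>{t}. ennreal (f t (pending rs S t)))"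
      by (simp add: f_def threshold_delay_def)
    also have "\<dots> \<le> (\<Sum>t. ennreal (f t (pending rs S t)))"
      by (rule sum_le_suminf) auto
    also have "\<dots> \<le> cost uniform_dist f rs S"
      by (simp add: cost_def)
    finally show ?thesis
      by (simp add: rs_def S_def)
  qed
qed

section \<open>The cost of an offline solution\<close>

lemma exists_rare_point:
  fixes p :: "nat \<Rightarrow> 'a"
  assumes "finite V" "V \<noteq> {}" "\<And>k. k < card V * b \<Longrightarrow> p k \<in> V"
  shows "\<exists>a\<in>V. card {k. k < card V * b \<and> p k = a} \<le> b"
proof (rule ccontr)
  assume "\<not> ?thesis"
  then have "(\<Sum>a\<in>V. b) < (\<Sum>a\<in>V. card {k. k < card V * b \<and> p k = a})"
    using assms by (intro sum_strict_mono) auto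
  also have "\<dots> = card (\<Union>a\<in>V. {k. k < card V * b \<and> p k = a})"
    using assms by (intro card_UN_disjoint[symmetric]) auto
  also have "\<dots> \<le> card {..<card V * b}"
    by (intro card_mono) auto
  finally show False by simp
qed

lemma uniform_opt_le:
  fixes rs :: "nat requests"
  assumes "finite V" "card V = n" "n \<ge> 2" and m: "m = n * b" "even m"
    and len: "length rs = m" "\<And>t. length (arrived rs t) = min m (Suc t)"
    and rs: "snd ` set rs \<subseteq> V"
  shows "opt uniform_dist (threshold_delay n m H) rs \<le> ennreal (real b + real n)"
proof -
  define p where "p k = snd (rs ! k)" for k
  have p: "p k \<in> V" if "k < m" for k
    using that rs len by (auto simp: p_def)
  have "V \<noteq> {}"
    using assms by auto
  then obtain a where a: "a \<in> V" "card {k. k < m \<and> p k = a} \<le> b"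
    using exists_rare_point[of V b p] p assms by auto
  have "\<not> V \<subseteq> {a}"
    using \<open>card V = n\<close> \<open>n \<ge> 2\<close> card_mono[of "{a}" V] by auto
  then obtain a' where a': "a' \<in> V" "a' \<noteq> a" by auto
  \<comment> \<open>Requests at \<open>a\<close> are treated as if they were at \<open>a'\<close>,
    which leaves \<open>n - 1\<close> classes and keeps the greedy pending set below the threshold
    \<open>n\<close>.\<close>
  define c where "c k = (if p k = a then a' else p k)" for k
  obtain S where S: "feasible rs S"
    "\<And>t. pending rs S t = (if t < m then greedy_pending c (Suc t) else {})"
    "\<And>t i j. (i, j) \<in> S t \<Longrightarrow> c i = c j \<or> i \<in> greedy_pending c m \<and> j \<in> greedy_pending c m"
    using exists_greedy_solution[OF len \<open>even m\<close>] by metis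
  have small: "card (greedy_pending c t) < n" if "t \<le> m" for t
  proof -
    have "c ` greedy_pending c t \<subseteq> V - {a}"
    proof (rule image_subsetI)
      fix k assume "k \<in> greedy_pending c t"
      then have "k < m"
        using greedy_pending_less[of k c t] that by simp
      then show "c k \<in> V - {a}"
        using p[of k] a' by (simp add: c_def)
    qed
    then have "card (greedy_pending c t) \<le> card (V - {a})"
      using greedy_pending_inj[of c t] \<open>finite V\<close> by (meson card_inj_on_le finite_Diff)
    then show ?thesis
      using a assms by auto
  qed
  \<comment> \<open>Before time \<open>m\<close> the class bound applies; from \<open>m\<close> on
    nothing is pending. Hence \<open>H\<close> does not enter the bound.\<close>
  have no_delay: "threshold_delay n m H t (pending rs S t) = 0" for t
    using small[of "Suc t"] by (auto simp: S(2) threshold_delay_def simp del: greedy_pending.simps)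
  \<comment> \<open>A pair at distance 1 within one class contains a request at \<open>a\<close>,
    because \<open>c\<close> identifies only \<open>a\<close> with \<open>a'\<close>; a pair across
    classes consists of leftovers. Either way its weight is at least 1.\<close>
  define h where "h k = of_bool (p k = a) + (of_bool (k \<in> greedy_pending c m) :: real)" for k
  have "(\<Sum>(i, j)\<in>(\<Union>t. S t). uniform_dist (snd (rs ! i)) (snd (rs ! j))) \<le>
      (\<Sum>(i, j)\<in>(\<Union>t. S t). h i + h j)"
  proof (rule sum_mono, clarify)
    fix i j t assume "(i, j) \<in> S t"
    from S(3)[OF this] show "uniform_dist (snd (rs ! i)) (snd (rs ! j)) \<le> h i + h j"
      by (auto simp: uniform_dist_def h_def c_def p_def[symmetric] split: if_splits)
  qed
  also have "\<dots> = (\<Sum>k<m. h k)"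
    using feasible_sum_pairs(2)[OF S(1)] len(1) by simp
  also have "\<dots> = real (card {k. k < m \<and> p k = a}) + real (card (greedy_pending c m))"
  proof -
    have "{..<m} \<inter> {k. p k = a} = {k. k < m \<and> p k = a}"
      "{..<m} \<inter> greedy_pending c m = greedy_pending c m"
      by (auto dest: greedy_pending_less)
    then show ?thesis
      by (simp add: h_def sum.distrib of_bool_def sum.If_cases flip: Collect_mem_eq)
  qed
  also have "\<dots> \<le> real b + real n"
    using a(2) small[of m] by auto
  finally have "cost uniform_dist (threshold_delay n m H) rs S \<le> ennreal (real b + real n)"
    unfolding cost_def no_delay by (simp add: ennreal_leI del: ennreal_plus)
  then show ?thesis
    unfolding opt_def using S(1) by (meson INF_lower2 mem_Collect_eq)
qed

section \<open>The lower bound on the competitive ratio\<close>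

theorem theorem4:
  "\<exists>c::real. c > 0 \<and> (\<exists>N::nat. \<forall>A. online_algorithm A \<longrightarrow>
     (\<forall>n\<ge>N. ennreal (c * real n) \<le> competitive_ratio A n))"
proof (intro exI[of _ "1 / 3 :: real"] exI[of _ "2 :: nat"] conjI allI impI)
  fix A :: algorithm and n :: nat
  assume A: "online_algorithm A" and "n \<ge> 2"
  define V where "V = {..<n}"
  \<comment> \<open>With \<open>2 * n\<close> requests per point on average, \<open>m\<close> is
    even, the algorithm pays at least \<open>n * n\<close> and the optimum is at most
    \<open>2 * n + n\<close>, which gives the constant 1/3. Merging two points is possible as
    \<open>n\<close> is at least 2.\<close>
  define m where "m = n * (2 * n)"
  define f where "f = threshold_delay n m (real m / 2)"
  define rs where "rs = adversary A V f m"
  have V: "finite V" "card V = n" "V \<noteq> {}"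
    using \<open>n \<ge> 2\<close> by (auto simp: V_def lessThan_empty_iff)
  have len: "length rs = m" "\<And>t. length (arrived rs t) = min m (Suc t)"
    by (simp_all add: rs_def arrived_adversary)
  have points: "snd ` set rs \<subseteq> V"
    unfolding rs_def by (rule adversary_in[OF V(1,3)])
  have "real m / 2 > 0"
    using \<open>n \<ge> 2\<close> by (simp add: m_def)
  then have inst: "mpmd_instance n V uniform_dist f rs"
    using \<open>n \<ge> 2\<close> V points len unfolding mpmd_instance_def f_def
    by (simp add: Metric_space_uniform_dist set_delay_threshold_delay size_based_threshold_delay
        m_def rs_def adversary_fst)
  then have "feasible rs (run A V uniform_dist f rs)"
    using A by (simp add: online_algorithm_def)
  then have alg: "ennreal (real m / 2) \<le> cost uniform_dist f rs (run A V uniform_dist f rs)"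
    using adversary_cost_ge[of V n A m] V \<open>n \<ge> 2\<close> by (simp add: f_def rs_def)
  have opt: "opt uniform_dist f rs \<le> ennreal (3 * real n)"
    using uniform_opt_le[OF V(1,2) \<open>n \<ge> 2\<close> m_def _ len points] by (simp add: f_def m_def)
  show "ennreal (1 / 3 * real n) \<le> competitive_ratio A n"
    unfolding competitive_ratio_def
  proof (rule Inf_greatest, clarify)
    fix r assume "competitive A n r"
    then have "cost uniform_dist f rs (run A V uniform_dist f rs) \<le> r * opt uniform_dist f rs"
      using inst by (simp add: competitive_def)
    with alg have "ennreal (real m / 2) \<le> r * opt uniform_dist f rs"
      by (rule order_trans)
    also have "\<dots> \<le> r * ennreal (3 * real n)"
      using opt by (rule mult_left_mono) simp
    finally have *: "ennreal (real m / 2) \<le> r * ennreal (3 * real n)" .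
    show "ennreal (1 / 3 * real n) \<le> r"
    proof (cases r)
      case (real x)
      then have "real m / 2 \<le> x * (3 * real n)"
        using * by (simp flip: ennreal_mult)
      then have "real n * real n \<le> real n * (3 * x)"
        by (simp add: m_def mult_ac)
      then have "real n \<le> 3 * x"
        using \<open>n \<ge> 2\<close> by simp
      then show ?thesis
        using real by (simp add: ennreal_leI)
    qed simp
  qed
qed simp

end
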